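(* For the ticker tape $\mathcal{X}$ of any independent set of $\mathcal{C}_n$, its period satisfies \[T(\mathcal{X})=\gcd(p,q)=\frac{\mathsf{Scale}(\mathcal{X})}{\deg(\mathcal{X})\,\mathrm{codeg}(\mathcal{X})}.\]
   Context: Let $n\ge2$ and $\mathcal{C}_n$ the cycle graph on $\mathbb{Z}_n=\{1,\dots,n\}$ with edges $\{i,i+1\}$ (mod $n$). Independent sets are binary vectors $x\in\{0,1\}^n$ with no two cyclically adjacent $1$s. The toggle $\tau_k$ changes $x_k$ from $1$ to $0$, from $0$ to $1$ if the result is independent, otherwise does nothing; $\tau=\tau_n\circ\cdots\circ\tau_1$, $x^{(i)}=\tau^i(x)$ for $i\in\mathbb{Z}$. The ticker tape $\mathcal{X}=(X_k)_{k\in\mathbb{Z}}$ has $X_{in+j}$ equal to the $j$-th entry of $x^{(i)}$ ($1\le j\le n$); $k$ is live if $X_k=1$. Its period $T(\mathcal{X})$ is the least $\ell>0$ with $X_{k+\ell}=X_k$ for all $k$. The successor $s$ sends live $k$ to the unique live element of $\{k+2,k+n+1\}$; the co-successor $c$ to the unique live element of $\{k+2n-2,k+2n-1\}$ (bijections on live entries). Snakes/co-snakes are orbits of $s$/$c$; $\alpha$, $\beta$ are their numbers. Step $k\to s(k)$ has type $E$ if $s(k)=k+2$, $D$ if $s(k)=k+n+1$; step $k\to c(k)$ has type $S$ if $c(k)=k+2n-1$, $L$ if $c(k)=k+2n-2$. The slither from live $k$ is the word of step types of $k\to s(k)\to\dots\to s^\beta(k)$; the co-slither from $k$ the word of step types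 of $k\to c(k)\to\dots\to c^\alpha(k)$. $\deg(\mathcal{X})$ is the length of the slither divided by its period as a cyclic word, and $\mathrm{codeg}(\mathcal{X})$ the length of the co-slither divided by its period as a cyclic word (independent of $k$). Write the slither from $k$ as $P^{\deg(\mathcal{X})}$ and the co-slither as $Q^{\mathrm{codeg}(\mathcal{X})}$, and set $p=s^{|P|}(k)-k$, $q=c^{|Q|}(k)-k$ (independent of $k$). The scale is $\mathsf{Scale}(\mathcal{X})=s^\beta(k)-k=c^\alpha(k)-k$ (independent of live $k$). *)

theory Defs
  imports Complex_Main "HOL-Number_Theory.Cong"
begin

text \<open>
  The vertices of the cycle graph are the integers \<open>1, \<dots>, n\<close>. A binary vector
  \<open>x\<close> is represented by the set of positions at which \<open>x\<close> has entry 1.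
\<close>

definition cycle_adjacent :: "nat \<Rightarrow> int \<Rightarrow> int \<Rightarrow> bool" where
  "cycle_adjacent n i j \<longleftrightarrow> [j = i + 1] (mod int n) \<or> [i = j + 1] (mod int n)"

definition independent_sets :: "nat \<Rightarrow> int set set" where
  "independent_sets n =
    {x. x \<subseteq> {1..int n} \<and> (\<forall>i\<in>x. \<forall>j\<in>x. \<not> cycle_adjacent n i j)}"

definition toggle :: "nat \<Rightarrow> int \<Rightarrow> int set \<Rightarrow> int set" where
  "toggle n k x =
    (if k \<in> x then x - {k}
     else if insert k x \<in> independent_sets n then insert k x
     else x)"

text \<open>\<open>fold\<close> applies the toggle at 1 first and the toggle at \<open>n\<close> last.\<close>

definition tau :: "nat \<Rightarrow> int set \<Rightarrow> int set" where
  "tau n = fold (toggle n) [1..int n]"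

text \<open>Integer powers of a bijection \<open>f\<close> of the set \<open>A\<close> onto itself.\<close>

definition int_iterate :: "'a set \<Rightarrow> ('a \<Rightarrow> 'a) \<Rightarrow> int \<Rightarrow> 'a \<Rightarrow> 'a" where
  "int_iterate A f i =
    (if 0 \<le> i then f ^^ nat i else inv_into A f ^^ nat (- i))"

lemma toggle_involution:
  assumes "x \<in> independent_sets n"
  shows "toggle n k x \<in> independent_sets n" "toggle n k (toggle n k x) = x"
proof -
  have "x - {k} \<in> independent_sets n"
    using assms unfolding independent_sets_def by blast
  then show "toggle n k x \<in> independent_sets n" "toggle n k (toggle n k x) = x"
    using assms by (simp_all add: toggle_def insert_absorb)
qed

lemma bij_betw_toggle: "bij_betw (toggle n k) (independent_sets n) (independent_sets n)"
  by (rule bij_betw_byWitness[where f' = "toggle n k"])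
    (simp_all add: toggle_involution image_subset_iff)

lemma bij_betw_tau: "bij_betw (tau n) (independent_sets n) (independent_sets n)"
proof -
  have "bij_betw (fold (toggle n) ks) (independent_sets n) (independent_sets n)" for ks
  proof (induction ks)
    case Nil
    show ?case by (simp add: bij_betw_def inj_on_def)
  next
    case (Cons k ks)
    show ?case
      unfolding fold.simps by (rule bij_betw_trans[OF bij_betw_toggle Cons.IH])
  qed
  then show ?thesis by (simp add: tau_def)
qed

text \<open>
  A tape is a function \<open>int \<Rightarrow> bool\<close>, with \<open>True\<close> for the entry 1; a position \<open>k\<close> is live
  if \<open>X k\<close> holds.
\<close>

definition ticker_tape :: "nat \<Rightarrow> int set \<Rightarrow> int \<Rightarrow> bool" where
  "ticker_tape n x k \<longleftrightarrow>
    (k - 1) mod int n + 1 \<in> int_iterate (independent_sets n) (tau n) ((k - 1) div int n) x"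

lemma ticker_tape_entry:
  assumes "1 \<le> j" "j \<le> int n"
  shows "ticker_tape n x (i * int n + j) \<longleftrightarrow>
    j \<in> int_iterate (independent_sets n) (tau n) i x"
proof -
  have *: "i * int n + j - 1 = (j - 1) + i * int n" by simp
  have "(j - 1) div int n = 0" "(j - 1) mod int n = j - 1"
    using assms by simp_all
  with assms show ?thesis by (simp add: ticker_tape_def *)
qed

definition tape_period :: "(int \<Rightarrow> bool) \<Rightarrow> nat" where
  "tape_period X = (LEAST l. 0 < l \<and> (\<forall>k. X (k + int l) = X k))"

definition live :: "(int \<Rightarrow> bool) \<Rightarrow> int set" where
  "live X = {k. X k}"

definition successor :: "nat \<Rightarrow> (int \<Rightarrow> bool) \<Rightarrow> int \<Rightarrow> int" where
  "successor n X k = (THE j. j \<in> {k + 2, k + int n + 1} \<and> j \<in> live X)"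

definition cosuccessor :: "nat \<Rightarrow> (int \<Rightarrow> bool) \<Rightarrow> int \<Rightarrow> int" where
  "cosuccessor n X k = (THE j. j \<in> {k + 2 * int n - 2, k + 2 * int n - 1} \<and> j \<in> live X)"

definition orbits :: "'a set \<Rightarrow> ('a \<Rightarrow> 'a) \<Rightarrow> 'a set set" where
  "orbits A f = {{int_iterate A f i a | i. True} | a. a \<in> A}"

definition snakes :: "nat \<Rightarrow> (int \<Rightarrow> bool) \<Rightarrow> int set set" where
  "snakes n X = orbits (live X) (successor n X)"

definition cosnakes :: "nat \<Rightarrow> (int \<Rightarrow> bool) \<Rightarrow> int set set" where
  "cosnakes n X = orbits (live X) (cosuccessor n X)"

definition num_snakes :: "nat \<Rightarrow> (int \<Rightarrow> bool) \<Rightarrow> nat" where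
  "num_snakes n X = card (snakes n X)"

definition num_cosnakes :: "nat \<Rightarrow> (int \<Rightarrow> bool) \<Rightarrow> nat" where
  "num_cosnakes n X = card (cosnakes n X)"

datatype step_type = Step_E | Step_D

datatype costep_type = Step_S | Step_L

definition step_type_of :: "nat \<Rightarrow> (int \<Rightarrow> bool) \<Rightarrow> int \<Rightarrow> step_type" where
  "step_type_of n X k = (if successor n X k = k + 2 then Step_E else Step_D)"

definition costep_type_of :: "nat \<Rightarrow> (int \<Rightarrow> bool) \<Rightarrow> int \<Rightarrow> costep_type" where
  "costep_type_of n X k =
    (if cosuccessor n X k = k + 2 * int n - 1 then Step_S else Step_L)"

text \<open>The slither has one letter per co-snake, the co-slither one letter per snake.\<close>

definition slither :: "nat \<Rightarrow> (int \<Rightarrow> bool) \<Rightarrow> int \<Rightarrow> step_type list" where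
  "slither n X k =
    map (\<lambda>i. step_type_of n X ((successor n X ^^ i) k)) [0..<num_cosnakes n X]"

definition coslither :: "nat \<Rightarrow> (int \<Rightarrow> bool) \<Rightarrow> int \<Rightarrow> costep_type list" where
  "coslither n X k =
    map (\<lambda>i. costep_type_of n X ((cosuccessor n X ^^ i) k)) [0..<num_snakes n X]"

definition cyclic_period :: "'a list \<Rightarrow> nat" where
  "cyclic_period w = (LEAST d. 0 < d \<and> rotate d w = w)"

text \<open>
  Several invariants of a tape are computed from an arbitrary live position and do not
  depend on it; \<open>common_value\<close> is the value shared by all live positions.
\<close>

definition common_value :: "(int \<Rightarrow> bool) \<Rightarrow> (int \<Rightarrow> 'a) \<Rightarrow> 'a" where
  "common_value X f = (THE v. \<forall>k\<in>live X. f k = v)"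

text \<open>The cyclic period of a word divides its length, so the divisions are exact.\<close>

definition tape_deg :: "nat \<Rightarrow> (int \<Rightarrow> bool) \<Rightarrow> nat" where
  "tape_deg n X =
    common_value X (\<lambda>k. length (slither n X k) div cyclic_period (slither n X k))"

definition tape_codeg :: "nat \<Rightarrow> (int \<Rightarrow> bool) \<Rightarrow> nat" where
  "tape_codeg n X =
    common_value X (\<lambda>k. length (coslither n X k) div cyclic_period (coslither n X k))"

text \<open>The word \<open>w\<close> such that \<open>v\<close> is the \<open>d\<close>-th power of \<open>w\<close>.\<close>

definition word_root :: "nat \<Rightarrow> 'a list \<Rightarrow> 'a list" where
  "word_root d v = (THE w. concat (replicate d w) = v)"

definition slither_shift :: "nat \<Rightarrow> (int \<Rightarrow> bool) \<Rightarrow> int" where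
  "slither_shift n X =
    common_value X
      (\<lambda>k. (successor n X ^^ length (word_root (tape_deg n X) (slither n X k))) k - k)"

definition coslither_shift :: "nat \<Rightarrow> (int \<Rightarrow> bool) \<Rightarrow> int" where
  "coslither_shift n X =
    common_value X
      (\<lambda>k. (cosuccessor n X ^^ length (word_root (tape_codeg n X) (coslither n X k))) k - k)"

definition tape_scale :: "nat \<Rightarrow> (int \<Rightarrow> bool) \<Rightarrow> int" where
  "tape_scale n X =
    (THE d. \<forall>k\<in>live X. (successor n X ^^ num_cosnakes n X) k - k = d
                      \<and> (cosuccessor n X ^^ num_snakes n X) k - k = d)"

end

theory Submission
  imports Defs
begin

text \<open>
  The tape obeys the local rule that \<open>k\<close> is live iff \<open>k - 1\<close>, \<open>k - n + 1\<close> and \<open>k - n\<close>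
  are not. It follows that successor and co-successor commute, that the type of a successor step
  does not change along co-snakes (and vice versa), and that the two maps together act
  transitively on the live positions. Hence the live positions are the values \<open>F a + G b\<close> for
  strictly increasing \<open>F, G\<close> on the integers, the successor raising \<open>a\<close> and the co-successor
  raising \<open>b\<close> by one. The pairs \<open>(a, b)\<close> that give the same position differ by the multiples
  of \<open>(\<beta>, -\<alpha>)\<close>, which yields the scale. A translation preserves the tape iff it moves
  \<open>a\<close> by a period of the increments of \<open>F\<close> and \<open>b\<close> by a period of those of \<open>G\<close>, so the
  translations are exactly the numbers \<open>x p + y q\<close> and \<open>T = gcd p q\<close>. Finally
  \<open>deg p = codeg q\<close> is the scale, and deg and codeg are coprime: if \<open>g\<close> divides both, then
  \<open>(\<beta> / g, -\<alpha> / g)\<close> already collides with \<open>(0, 0)\<close>.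
\<close>

section \<open>Integer preliminaries\<close>

text \<open>An equivalence between neighbours propagates upwards and downwards, so a single step
  case covers all integers from any base point.\<close>

lemma int_induct_iff:
  fixes P :: "int \<Rightarrow> bool"
  assumes "\<And>i. P i \<longleftrightarrow> P (i + 1)" "P j"
  shows "P i"
proof (induction i rule: int_induct[where k = j])
  case (step2 i)
  then show ?case using assms(1)[of "i - 1"] by simp
qed (use assms in auto)

text \<open>A nonempty set closed under subtraction is a subgroup, and the remainder of a member
  modulo the least positive member is again a member, hence zero.\<close>

lemma int_subgroup_multiples:
  fixes H :: "int \<Rightarrow> bool"
  assumes diff: "\<And>x y. H x \<Longrightarrow> H y \<Longrightarrow> H (x - y)" and "H m" "m \<noteq> 0"
  defines "d \<equiv> (LEAST l. 0 < l \<and> H (int l))"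
  shows "0 < d" "H x \<longleftrightarrow> int d dvd x"
proof -
  have H0: "H 0" using diff[OF \<open>H m\<close> \<open>H m\<close>] by simp
  have neg: "H (- x)" if "H x" for x using diff[OF H0 that] by simp
  have add: "H (x + y)" if "H x" "H y" for x y using diff[OF that(1) neg[OF that(2)]] by simp
  have "H \<bar>m\<bar>" using \<open>H m\<close> neg[of m] by (auto simp: abs_if)
  then have "0 < nat \<bar>m\<bar> \<and> H (int (nat \<bar>m\<bar>))" using \<open>m \<noteq> 0\<close> by simp
  then have d: "0 < d \<and> H (int d)" unfolding d_def by (rule LeastI)
  then show "0 < d" ..
  have mult: "H (int d * y)" for y
  proof (rule int_induct_iff[where j = 0 and P = "\<lambda>y. H (int d * y)"])
    show "H (int d * i) \<longleftrightarrow> H (int d * (i + 1))" for i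
      using add[of "int d * i" "int d"] diff[of "int d * (i + 1)" "int d"] d
      by (auto simp: algebra_simps)
  qed (use H0 in simp)
  show "H x \<longleftrightarrow> int d dvd x"
  proof
    assume "H x"
    have "H (x mod int d)"
      using diff[OF \<open>H x\<close> mult[of "x div int d"]] by (simp add: minus_mult_div_eq_mod)
    moreover have "0 \<le> x mod int d" "x mod int d < int d" using d by simp_all
    ultimately have "\<not> 0 < nat (x mod int d)"
      using not_less_Least[of "nat (x mod int d)" "\<lambda>l. 0 < l \<and> H (int l)"] d_def by auto
    with \<open>0 \<le> x mod int d\<close> show "int d dvd x" by (simp add: dvd_eq_mod_eq_0)
  qed (use mult in \<open>auto simp: dvd_def\<close>)
qed

text \<open>\<open>f\<close> factors injectively through the integers modulo \<open>H\<close>.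
  Finiteness excludes the trivial subgroup, so \<open>H\<close> consists of the multiples of some
  \<open>d > 0\<close> and the residues below \<open>d\<close> enumerate the range without
  repetition.\<close>

lemma card_range_dvd:
  fixes f :: "int \<Rightarrow> 'a"
  assumes eq: "\<And>a b. f a = f b \<longleftrightarrow> H (a - b)" and fin: "finite (range f)"
  shows "0 < card (range f)" "H x \<longleftrightarrow> int (card (range f)) dvd x"
proof -
  have diff: "H (x - y)" if "H x" "H y" for x y
    using that eq[of x 0] eq[of y 0] eq[of x y] by simp
  have "\<not> inj f" using fin finite_imageD by fastforce
  then obtain a b where "H (a - b)" "a - b \<noteq> 0" by (auto simp: inj_def eq)
  define d where "d = (LEAST l. 0 < l \<and> H (int l))"
  have d: "0 < d" "\<And>x. H x \<longleftrightarrow> int d dvd x"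
    unfolding d_def
    by (rule int_subgroup_multiples[where H = H, OF diff \<open>H (a - b)\<close> \<open>a - b \<noteq> 0\<close>]; assumption)+
  have "f a = f (a mod int d)" for a
    using d by (simp add: eq minus_mod_eq_mult_div)
  moreover have "a mod int d \<in> {0..<int d}" for a using d by simp
  ultimately have "range f = f ` {0..<int d}" by blast
  moreover have "inj_on f {0..<int d}"
  proof (rule inj_onI)
    fix x y assume "x \<in> {0..<int d}" "y \<in> {0..<int d}" "f x = f y"
    then show "x = y" using d(2)[of "x - y"] eq[of x y] zdvd_not_zless
      by (metis atLeastLessThan_iff mod_eq_dvd_iff mod_pos_pos_trivial)
  qed
  ultimately have "card (range f) = d" by (simp add: card_image)
  with d show "0 < card (range f)" "H x \<longleftrightarrow> int (card (range f)) dvd x" by simp_all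
qed

section \<open>Integer powers of a bijection\<close>

lemma int_iterate_simps:
  assumes "bij_betw f A A" "x \<in> A"
  shows "int_iterate A f 0 x = x" "int_iterate A f i x \<in> A"
    "int_iterate A f (i + 1) x = f (int_iterate A f i x)"
proof -
  have inA: "inv_into A f y \<in> A" if "y \<in> A" for y
    using that assms(1) by (metis bij_betw_def inv_into_into)
  have f: "f y \<in> A" if "y \<in> A" for y
    using that assms(1) by (metis bij_betwE)
  have m1: "(inv_into A f ^^ m) x \<in> A" for m by (induction m) (use assms inA in auto)
  have m2: "(f ^^ m) x \<in> A" for m by (induction m) (use assms f in auto)
  show "int_iterate A f 0 x = x" by (simp add: int_iterate_def)
  show "int_iterate A f i x \<in> A" using m1 m2 by (simp add: int_iterate_def)
  show "int_iterate A f (i + 1) x = f (int_iterate A f i x)"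
  proof (cases "0 \<le> i")
    case True
    then show ?thesis by (simp add: int_iterate_def nat_add_distrib)
  next
    case False
    then have "nat (- i) = Suc (nat (- (i + 1)))" by simp
    then have "f (int_iterate A f i x) = (inv_into A f ^^ nat (- (i + 1))) x"
      using False m1 assms(1) by (simp add: int_iterate_def bij_betw_inv_into_right)
    \<comment> \<open>The boundary case is \<open>i = -1\<close>: the exponent becomes 0 and the
      definition changes branch, but both branches are then the identity.\<close>
    then show ?thesis using False by (auto simp: int_iterate_def)
  qed
qed

section \<open>Additive periods\<close>

text \<open>The function may grow; what stays constant is its gain over a window of length
  \<open>d\<close>. This amounts to periodicity of the increments, and so captures the periods of
  step words.\<close>

definition additive_period :: "(int \<Rightarrow> int) \<Rightarrow> int \<Rightarrow> bool" where
  "additive_period f d \<longleftrightarrow> (\<forall>a. f (a + d) - f a = f d - f 0)"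

definition least_additive_period :: "(int \<Rightarrow> int) \<Rightarrow> nat" where
  "least_additive_period f = (LEAST d. 0 < d \<and> additive_period f (int d))"

text \<open>Sliding the window from \<open>a\<close> to \<open>a + 1\<close> changes the gain by the
  difference of the increments at its two ends.\<close>

lemma additive_period_iff_steps:
  "additive_period f d \<longleftrightarrow> (\<forall>a. f (a + d + 1) - f (a + d) = f (a + 1) - f a)"
proof
  assume *: "additive_period f d"
  show "\<forall>a. f (a + d + 1) - f (a + d) = f (a + 1) - f a"
  proof
    fix a
    have "f (a + d) - f a = f (a + 1 + d) - f (a + 1)"
      using * unfolding additive_period_def by metis
    then show "f (a + d + 1) - f (a + d) = f (a + 1) - f a"
      by (simp add: ac_simps)
  qed
next
  assume *: "\<forall>a. f (a + d + 1) - f (a + d) = f (a + 1) - f a"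
  have "f (a + d) - f a = f d - f 0" for a
  proof (rule int_induct_iff[where j = 0 and P = "\<lambda>a. f (a + d) - f a = f d - f 0"])
    show "f (i + d) - f i = f d - f 0 \<longleftrightarrow> f (i + 1 + d) - f (i + 1) = f d - f 0" for i
      using *[rule_format, of i] by (simp add: ac_simps) linarith
  qed simp
  then show "additive_period f d" by (simp add: additive_period_def)
qed

lemma additive_period_diff:
  assumes "additive_period f d" "additive_period f e"
  shows "additive_period f (d - e)"
proof -
  have "f (a + (d - e)) - f a = f d - f 0 - (f e - f 0)" for a
    using assms[unfolded additive_period_def, rule_format, of "a - e"]
      assms(2)[unfolded additive_period_def, rule_format, of "a - e"]
    by (simp add: algebra_simps)
  from this this[of 0] show ?thesis by (simp add: additive_period_def)
qed

lemma additive_period_mult: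
  assumes "additive_period f d"
  shows "f (a + m * d) = f a + m * (f d - f 0)"
proof (rule int_induct_iff[where j = 0 and P = "\<lambda>m. f (a + m * d) = f a + m * (f d - f 0)"])
  show "f (a + i * d) = f a + i * (f d - f 0) \<longleftrightarrow>
      f (a + (i + 1) * d) = f a + (i + 1) * (f d - f 0)" for i
    using assms[unfolded additive_period_def, rule_format, of "a + i * d"]
    by (auto simp: algebra_simps)
qed simp

lemma additive_period_iff_least_dvd:
  assumes "additive_period f m" "m \<noteq> 0"
  shows "0 < least_additive_period f"
    "additive_period f d \<longleftrightarrow> int (least_additive_period f) dvd d"
  unfolding least_additive_period_def
  by (rule int_subgroup_multiples[where H = "additive_period f", OF additive_period_diff assms]; assumption)+

text \<open>\<open>w\<close> is a window of \<open>N\<close> letters in a bi-infinite letter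
  sequence that repeats after \<open>N\<close>, so rotating \<open>w\<close> by \<open>d\<close>
  fixes it iff shifting the sequence by \<open>d\<close> does. The start \<open>a\<close> is
  arbitrary, which is why the derived invariants do not depend on the live position.\<close>

lemma cyclic_period_steps:
  fixes f :: "int \<Rightarrow> int" and a :: int
  assumes per: "additive_period f (int N)" and "0 < N"
    and inj: "inj_on h (range (\<lambda>i. f (i + 1) - f i))"
  defines "w \<equiv> map (\<lambda>i. h (f (a + int i + 1) - f (a + int i))) [0..<N]"
  shows "cyclic_period w = least_additive_period f"
    "length w div cyclic_period w = N div least_additive_period f"
    "word_root (N div least_additive_period f) w = take (least_additive_period f) w"
    "length (take (least_additive_period f) w) = least_additive_period f"
proof -
  define g where "g i = h (f (a + i + 1) - f (a + i))" for i
  have w: "w ! i = g (int i)" if "i < N" for i using that by (simp add: w_def g_def)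
  have len: "length w = N" by (simp add: w_def)
  have gN: "g (i mod int N) = g i" for i
  proof -
    have "additive_period f (int N * (i div int N))"
      using additive_period_iff_least_dvd[OF per] \<open>0 < N\<close> per by auto
    then have "g (i mod int N + int N * (i div int N)) = g (i mod int N)"
      unfolding additive_period_iff_steps g_def by (metis add.assoc)
    then show ?thesis by simp
  qed
  have rot: "rotate d w = w \<longleftrightarrow> additive_period f (int d)" for d
  proof -
    have "rotate d w = w \<longleftrightarrow> (\<forall>i<N. g (int i + int d) = g (int i))"
      by (auto simp: list_eq_iff_nth_eq len nth_rotate w gN zmod_int ac_simps \<open>0 < N\<close>)
    also have "\<dots> \<longleftrightarrow> (\<forall>i. g (i + int d) = g i)"
    proof (intro iffI allI impI)
      fix i assume *: "\<forall>i<N. g (int i + int d) = g (int i)"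
      have "g (i mod int N + int d) = g (i mod int N)"
        using *[rule_format, of "nat (i mod int N)"] \<open>0 < N\<close> by (simp add: nat_less_iff)
      then show "g (i + int d) = g i"
        using gN by (metis mod_add_left_eq)
    qed simp
    also have "\<dots> \<longleftrightarrow> additive_period f (int d)"
    proof
      assume *: "\<forall>i. g (i + int d) = g i"
      \<comment> \<open>Equal letters give equal increments because \<open>h\<close> is injective on
        the increments that occur.\<close>
      have "f (i + int d + 1) - f (i + int d) = f (i + 1) - f i" for i
        using *[rule_format, of "i - a"] inj unfolding g_def inj_on_def by simp
      then show "additive_period f (int d)" by (simp add: additive_period_iff_steps)
    next
      assume "additive_period f (int d)"
      then show "\<forall>i. g (i + int d) = g i"
        unfolding additive_period_iff_steps g_def by (metis add.assoc)
    qed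
    finally show ?thesis .
  qed
  let ?P = "least_additive_period f"
  show "cyclic_period w = ?P"
    by (simp add: cyclic_period_def rot least_additive_period_def)
  then show "length w div cyclic_period w = N div ?P" by (simp add: len)
  have P: "0 < ?P" "?P dvd N" "additive_period f (int ?P)"
    using additive_period_iff_least_dvd[OF per] per \<open>0 < N\<close> by auto
  then have "?P \<le> N" using \<open>0 < N\<close> by (simp add: dvd_imp_le)
  then show "length (take ?P w) = ?P" by (simp add: len)
  define m where "m = N div ?P"
  have Nm: "N = m * ?P" "0 < m" using P \<open>0 < N\<close> by (auto simp: m_def)
  have gP: "g (i + j * int ?P) = g i" for i j
  proof -
    have "additive_period f (j * int ?P)"
      using additive_period_iff_least_dvd[OF per] \<open>0 < N\<close> by auto
    then show ?thesis unfolding additive_period_iff_steps g_def by (metis add.assoc)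
  qed
  have conc: "concat (replicate j (map (\<lambda>i. g (int i)) [0..<?P])) =
      map (\<lambda>i. g (int i)) [0..<j * ?P]" for j
  proof (induction j)
    case (Suc j)
    have "[0..<Suc j * ?P] = [0..<?P] @ map (\<lambda>i. i + ?P) [0..<j * ?P]"
      using upt_add_eq_append[of 0 ?P "j * ?P"] by (simp add: map_add_upt add.commute)
    then show ?case using Suc gP[of _ 1] by (simp add: o_def)
  qed simp
  have w_eq: "w = map (\<lambda>i. g (int i)) [0..<N]" by (simp add: w_def g_def)
  have "take ?P w = map (\<lambda>i. g (int i)) [0..<?P]"
    using \<open>?P \<le> N\<close> by (simp add: w_eq take_map)
  then have c: "concat (replicate m (take ?P w)) = w"
    using conc[of m, folded Nm(1)] by (simp only: w_eq)
  show "word_root (N div ?P) w = take ?P w"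
    unfolding word_root_def m_def[symmetric]
  proof (rule the_equality)
    show "concat (replicate m (take ?P w)) = w" by (rule c)
    \<comment> \<open>Comparing lengths with \<open>m > 0\<close> fixes the length of
      \<open>v\<close>, and \<open>v\<close> is a prefix of \<open>w\<close>.\<close>
    fix v assume v: "concat (replicate m v) = w"
    have "m * length v = length (concat (replicate m v))"
      by (simp add: length_concat sum_list_replicate)
    then have "m * length v = m * ?P" using v len Nm(1) by metis
    then have "length v = ?P" using Nm(2) by simp
    moreover have "\<exists>u. w = v @ u" using v Nm by (cases m) auto
    ultimately show "v = take ?P w" by auto
  qed
qed

section \<open>Grids of live positions\<close>

text \<open>The pair \<open>(a, b)\<close> serves as coordinates of a live position, in general not
  unique ones. The bound \<open>M\<close> on single steps makes the number of orbits finite. The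
  last two assumptions let the step maps commute with every symmetry of the tape.\<close>

locale step_grid =
  fixes L :: "int set" and s c :: "int \<Rightarrow> int" and F G :: "int \<Rightarrow> int" and M :: int
  assumes L_eq: "L = {F a + G b | a b. True}"
    and s_grid: "s (F a + G b) = F (a + 1) + G b"
    and c_grid: "c (F a + G b) = F a + G (b + 1)"
    and inj_s: "inj_on s L" and inj_c: "inj_on c L"
    and F_less: "F a < F (a + 1)" and G_less: "G b < G (b + 1)"
    and F_bound: "F (a + 1) \<le> F a + M" and G_bound: "G (b + 1) \<le> G b + M"
    and s_shift: "\<lbrakk>\<And>k. k + t \<in> L \<longleftrightarrow> k \<in> L; k \<in> L\<rbrakk> \<Longrightarrow> s (k + t) = s k + t"
    and c_shift: "\<lbrakk>\<And>k. k + t \<in> L \<longleftrightarrow> k \<in> L; k \<in> L\<rbrakk> \<Longrightarrow> c (k + t) = c k + t"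
begin

text \<open>Duality: each result about \<open>s\<close> and \<open>F\<close> yields its counterpart
  for \<open>c\<close> and \<open>G\<close>.\<close>

lemma swap: "step_grid L c s G F M"
proof
  show "L = {G a + F b | a b. True}" unfolding L_eq by (auto; metis add.commute)
  show "c (G a + F b) = G (a + 1) + F b" for a b using c_grid[of b a] by (simp add: add.commute)
  show "s (G a + F b) = G a + F (b + 1)" for a b using s_grid[of b a] by (simp add: add.commute)
qed (fact inj_s inj_c F_less G_less F_bound G_bound s_shift c_shift)+

lemma grid_mem [simp]: "F a + G b \<in> L"
  by (auto simp: L_eq)

lemma bij_s: "bij_betw s L L"
proof -
  have "s ` L = L"
  proof
    show "s ` L \<subseteq> L"
      using grid_mem by (auto simp: L_eq s_grid simp del: grid_mem)
    show "L \<subseteq> s ` L"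
    proof
      fix k assume "k \<in> L"
      then obtain a b where "k = F a + G b" by (auto simp: L_eq)
      then have "k = s (F (a - 1) + G b)" by (simp add: s_grid)
      then show "k \<in> s ` L" by simp
    qed
  qed
  with inj_s show ?thesis by (simp add: bij_betw_def)
qed

lemma s_funpow: "(s ^^ m) (F a + G b) = F (a + int m) + G b"
  by (induction m) (simp_all add: s_grid add.assoc add.commute[of 1])

lemma s_int_iterate: "int_iterate L s i (F a + G b) = F (a + i) + G b"
proof (rule int_induct_iff[where j = 0 and P = "\<lambda>i. int_iterate L s i (F a + G b) = F (a + i) + G b"])
  note it = int_iterate_simps[OF bij_s grid_mem[of a b]]
  show "int_iterate L s 0 (F a + G b) = F (a + 0) + G b" by (simp add: it)
  show "int_iterate L s i (F a + G b) = F (a + i) + G b \<longleftrightarrow>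
      int_iterate L s (i + 1) (F a + G b) = F (a + (i + 1)) + G b" for i
    unfolding it add.assoc[symmetric] s_grid[symmetric]
    using inj_s it(2) grid_mem by (metis inj_on_eq_iff)
qed

lemma F_strict_mono: "a < b \<Longrightarrow> F a < F b"
proof (induction b rule: int_gr_induct)
  case (step b)
  then show ?case using F_less[of b] by linarith
qed (rule F_less)

lemma F_eq_iff [simp]: "F a = F b \<longleftrightarrow> a = b"
  using F_strict_mono[of a b] F_strict_mono[of b a] by (cases a b rule: linorder_cases) auto

section \<open>Coinciding coordinates and the number of orbits\<close>

lemma F_shift_iff: "F (a + i) + G b = F (a' + i) + G b' \<longleftrightarrow> F a + G b = F a' + G b'"
proof (rule int_induct_iff[where j = 0 and
    P = "\<lambda>i. F (a + i) + G b = F (a' + i) + G b' \<longleftrightarrow> F a + G b = F a' + G b'"])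
  show "(F (a + i) + G b = F (a' + i) + G b' \<longleftrightarrow> F a + G b = F a' + G b') \<longleftrightarrow>
     (F (a + (i + 1)) + G b = F (a' + (i + 1)) + G b' \<longleftrightarrow> F a + G b = F a' + G b')" for i
    unfolding add.assoc[symmetric] s_grid[symmetric]
    using inj_on_eq_iff[OF inj_s grid_mem grid_mem] by metis
qed simp

text \<open>These pairs form the lattice of coordinate shifts that leave every position fixed, the
  kernel of the passage from coordinates to positions.\<close>

definition collision :: "int \<Rightarrow> int \<Rightarrow> bool" where
  "collision A B \<longleftrightarrow> (\<forall>a b. F (a + A) + G (b + B) = F a + G b)"

lemma collisionD: "collision A B \<Longrightarrow> F (a + A) + G (b + B) = F a + G b"
  by (simp add: collision_def)

text \<open>One coincidence suffices: the injective maps \<open>s\<close> and \<open>c\<close> carry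
  it forwards and backwards to all coordinates.\<close>

lemma collisionI:
  assumes "F (a + A) + G (b + B) = F a + G b"
  shows "collision A B"
  unfolding collision_def
proof (intro allI)
  interpret sw: step_grid L c s G F M by (rule swap)
  fix a' b'
  have "F (a' + A) + G (b + B) = F a' + G b"
    using assms F_shift_iff[of "a + A" "a' - a" "b + B" a b] by (simp add: ac_simps)
  then show "F (a' + A) + G (b' + B) = F a' + G b'"
    using sw.F_shift_iff[of "b + B" "b' - b" "a' + A" b a'] by (simp add: add.commute)
qed

lemma collision_diff:
  assumes "collision A B" "collision A' B'"
  shows "collision (A - A') (B - B')"
proof (rule collisionI)
  show "F (A' + (A - A')) + G (B' + (B - B')) = F A' + G B'"
    using collisionD[OF assms(1), of 0 0] collisionD[OF assms(2), of 0 0] by simp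
qed

lemma collision_mult:
  assumes "collision A B"
  shows "collision (m * A) (m * B)"
proof (rule int_induct_iff[where j = 0 and P = "\<lambda>m. collision (m * A) (m * B)"])
  \<comment> \<open>Only differences are available, so the upward step writes
    \<open>A + i * A\<close> as \<open>A - ((A - A) - i * A)\<close>.\<close>
  show "collision (i * A) (i * B) \<longleftrightarrow> collision ((i + 1) * A) ((i + 1) * B)" for i
    using collision_diff[OF _ assms, of "(i + 1) * A" "(i + 1) * B"]
      collision_diff[OF assms collision_diff[OF collision_diff[OF assms assms]], of "i * A" "i * B"]
    by (auto simp: algebra_simps)
qed (simp add: collision_def)

lemma collision_zero_right [simp]: "collision A 0 \<longleftrightarrow> A = 0"
  by (auto simp: collision_def)

text \<open>Fixing \<open>a\<close> and varying \<open>b\<close> gives a co-snake, and two co-snakes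
  agree iff some collision links their first coordinates. Once a bounded window is seen to meet
  every co-snake, \<open>card_range_dvd\<close> applies.\<close>

lemma card_c_orbits:
  shows "0 < card (orbits L c)"
    "(\<exists>B. collision A B) \<longleftrightarrow> int (card (orbits L c)) dvd A"
proof -
  interpret sw: step_grid L c s G F M by (rule swap)
  define orb where "orb a = {F a + G b | b. True}" for a
  have "{int_iterate L c i (F a + G b) | i. True} = orb a" for a b
  proof -
    have "int_iterate L c i (F a + G b) = F a + G (b + i)" for i
      using sw.s_int_iterate[of i b a] by (simp add: add.commute)
    moreover have "\<exists>i. b' = b + i" for b' :: int by (rule exI[of _ "b' - b"]) simp
    ultimately show ?thesis unfolding orb_def by (auto; metis)
  qed
  then have orbits: "orbits L c = range orb"
    unfolding orbits_def L_eq by (auto; metis)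
  have eq: "orb a = orb a' \<longleftrightarrow> (\<exists>B. collision (a - a') B)" for a a'
  proof
    assume "orb a = orb a'"
    then have "F a + G 0 \<in> orb a'" by (auto simp: orb_def)
    then obtain b where "F (a' + (a - a')) + G (b + - b) = F a' + G b" by (auto simp: orb_def)
    then show "\<exists>B. collision (a - a') B" by (blast intro: collisionI)
  next
    assume "\<exists>B. collision (a - a') B"
    then obtain B where B: "collision (a - a') B" ..
    have "F a + G b = F a' + G (b - B)" "F a' + G b = F a + G (b + B)" for b
      using collisionD[OF B, of a' "b - B"] collisionD[OF B, of a' b] by simp_all
    then show "orb a = orb a'" unfolding orb_def by blast
  qed
  have meets: "orb a \<inter> {0..M} \<noteq> {}" for a
  proof -
    have le: "G 0 + int m \<le> G (int m)" "G (- int m) \<le> G 0 - int m" for m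
    proof (induction m)
      case (Suc m)
      { case 1 show ?case using Suc(1) G_less[of "int m"] by (simp add: add.commute)
      next
        case 2 show ?case using Suc(2) G_less[of "- 1 - int m"] by (simp add: algebra_simps) }
    qed simp_all
    \<comment> \<open>The position with index \<open>- r\<close> is at most 0 and the one with index
      \<open>r\<close> at least 0. The first nonnegative position from \<open>- r\<close> onwards is
      either the starting one or is reached from a negative one by a step of length at most
      \<open>M\<close>.\<close>
    define r where "r = nat \<bar>F a + G 0\<bar>"
    have "\<exists>m. 0 \<le> F a + G (int m - int r)"
      using le(1)[of r] by (intro exI[of _ "2 * r"]) (simp add: r_def)
    then obtain m where m: "0 \<le> F a + G (int m - int r)"
      and least: "\<And>j. j < m \<Longrightarrow> F a + G (int j - int r) < 0"
      using exists_least_iff[of "\<lambda>m. 0 \<le> F a + G (int m - int r)"] by (metis not_le)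
    have "F a + G (int m - int r) \<le> M"
    proof (cases m)
      case 0
      have "F a + G (- int r) \<le> 0" using le(2)[of r] by (simp add: r_def)
      moreover have "0 \<le> M" using F_less[of 0] F_bound[of 0] by linarith
      ultimately show ?thesis using 0 by simp
    next
      case (Suc j)
      then show ?thesis using least[of j] G_bound[of "int j - int r"] by (simp add: algebra_simps)
    qed
    with m show ?thesis by (auto simp: orb_def)
  qed
  have disj: "orb a = orb a'" if "k \<in> orb a'" "k \<in> orb a" for a a' k
  proof -
    from that obtain b b' where "F a + G b = F a' + G b'" by (auto simp: orb_def) metis
    then have "F (a' + (a - a')) + G (b' + (b - b')) = F a' + G b'" by simp
    then show ?thesis using eq collisionI by blast
  qed
  \<comment> \<open>Orbits sharing a position coincide, so each orbit is recovered from any of its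
    positions in the window.\<close>
  have "range orb \<subseteq> (\<lambda>k. THE R. R \<in> range orb \<and> k \<in> R) ` {0..M}"
  proof -
    have "orb a \<in> (\<lambda>k. THE R. R \<in> range orb \<and> k \<in> R) ` {0..M}" for a
    proof -
      obtain k where k: "k \<in> orb a" "k \<in> {0..M}" using meets[of a] by blast
      then have "(THE R. R \<in> range orb \<and> k \<in> R) = orb a"
      proof (intro the_equality)
        fix R assume "R \<in> range orb \<and> k \<in> R"
        then obtain a' where "R = orb a'" "k \<in> orb a'" by blast
        then show "R = orb a" using disj[OF k(1), of a'] by simp
      qed simp
      then show ?thesis using k(2) by (intro image_eqI[where x = k]) (rule sym)
    qed
    then show ?thesis by blast
  qed
  then have "finite (range orb)" by (rule finite_subset) simp
  from card_range_dvd[OF eq this]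
  show "0 < card (orbits L c)" "(\<exists>B. collision A B) \<longleftrightarrow> int (card (orbits L c)) dvd A"
    by (simp_all add: orbits)
qed


lemma collision_swap: "step_grid.collision G F B A \<longleftrightarrow> collision A B"
proof -
  interpret sw: step_grid L c s G F M by (rule swap)
  show ?thesis unfolding collision_def sw.collision_def by (metis add.commute)
qed

lemma card_s_orbits:
  shows "0 < card (orbits L s)"
    "(\<exists>A. collision A B) \<longleftrightarrow> int (card (orbits L s)) dvd B"
  using step_grid.card_c_orbits[OF swap] by (simp_all add: collision_swap)

text \<open>The first coordinates of collisions are the multiples of \<beta>, the second ones those
  of \<alpha>. Comparing a collision starting with \<beta> to one ending with \<alpha> shows that
  the former ends with \<alpha> or its negative; the positive sign would move the position strictly
  upwards.\<close>

lemma collision_card_orbits: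
  "collision (int (card (orbits L c))) (- int (card (orbits L s)))"
proof -
  interpret sw: step_grid L c s G F M by (rule swap)
  define \<beta> \<alpha> where "\<beta> = int (card (orbits L c))" and "\<alpha> = int (card (orbits L s))"
  have pos: "0 < \<beta>" "0 < \<alpha>" using card_c_orbits card_s_orbits by (simp_all add: \<beta>_def \<alpha>_def)
  have \<beta>: "(\<exists>B. collision A B) \<longleftrightarrow> \<beta> dvd A" for A
    using card_c_orbits by (simp add: \<beta>_def)
  have \<alpha>: "(\<exists>A. collision A B) \<longleftrightarrow> \<alpha> dvd B" for B
    using card_s_orbits by (simp add: \<alpha>_def)
  obtain v where v: "collision \<beta> v" using \<beta>[of \<beta>] by auto
  obtain w where w: "collision w \<alpha>" using \<alpha>[of \<alpha>] by auto
  obtain v' where v': "v = \<alpha> * v'" using \<alpha>[of v] v by (auto simp: dvd_def)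
  obtain w' where w': "w = \<beta> * w'" using \<beta>[of w] w by (auto simp: dvd_def)
  \<comment> \<open>The multiple \<open>w'\<close> makes the first coordinate vanish, which forces
    the second to vanish.\<close>
  have "collision (w' * \<beta> - w) (w' * v - \<alpha>)"
    by (rule collision_diff[OF collision_mult[OF v] w])
  then have "sw.collision (w' * v - \<alpha>) 0" by (simp add: collision_swap w')
  then have "\<alpha> * (w' * v') = \<alpha> * 1" by (simp add: v')
  then have "v' * w' = 1" using pos by (simp add: mult.commute)
  then consider "v' = 1" | "v' = -1" by (auto simp: zmult_eq_1_iff)
  then have "v = - \<alpha>"
  proof cases
    case 1
    then have "F \<beta> + G \<alpha> = F 0 + G 0" using collisionD[OF v, of 0 0] v' by simp
    moreover have "F 0 < F \<beta>" "G 0 < G \<alpha>" using pos F_strict_mono sw.F_strict_mono by simp_all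
    ultimately show ?thesis by simp
  qed (simp add: v')
  with v show ?thesis by (simp add: \<alpha>_def \<beta>_def)
qed

text \<open>This common distance, of \<beta> successor steps and of \<alpha> co-successor steps, is
  the scale.\<close>

lemma scale_eq: "F (a + int (card (orbits L c))) - F a = G (b + int (card (orbits L s))) - G b"
  using collisionD[OF collision_card_orbits, of a "b + int (card (orbits L s))"] by simp

section \<open>Additive periods and translations of the tape\<close>

lemma additive_period_card_orbits: "additive_period F (int (card (orbits L c)))"
  unfolding additive_period_def using scale_eq[of _ 0] scale_eq[of 0 0] by simp

lemma least_period_F:
  shows "0 < least_additive_period F"
    "additive_period F A \<longleftrightarrow> int (least_additive_period F) dvd A"
  using additive_period_iff_least_dvd[OF additive_period_card_orbits] card_c_orbits(1) by simp_all

text \<open>A translation preserving the tape commutes with \<open>s\<close> and \<open>c\<close>,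
  so the image \<open>(A, B)\<close> of the origin determines it as a shift of coordinates.
  Following the two axes through the origin shows that \<open>A\<close> and \<open>B\<close> are
  additive periods.\<close>

lemma translation_iff:
  "(\<forall>k. k + t \<in> L \<longleftrightarrow> k \<in> L) \<longleftrightarrow>
    (\<exists>A B. additive_period F A \<and> additive_period G B \<and> t = F A - F 0 + (G B - G 0))"
proof
  assume "\<exists>A B. additive_period F A \<and> additive_period G B \<and> t = F A - F 0 + (G B - G 0)"
  then obtain A B where AB: "additive_period F A" "additive_period G B"
    and t: "t = F A - F 0 + (G B - G 0)" by blast
  have shift: "F a + G b + t = F (a + A) + G (b + B)" for a b
    using AB[unfolded additive_period_def, rule_format, of a]
      AB(2)[unfolded additive_period_def, rule_format, of b] t by simp
  show "\<forall>k. k + t \<in> L \<longleftrightarrow> k \<in> L"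
  proof (intro allI iffI)
    fix k assume "k \<in> L"
    then show "k + t \<in> L" using shift by (auto simp: L_eq)
  next
    fix k assume "k + t \<in> L"
    then obtain a b where "k + t = F a + G b" by (auto simp: L_eq)
    then have "k = F (a - A) + G (b - B)" using shift[of "a - A" "b - B"] by simp
    then show "k \<in> L" by simp
  qed
next
  assume t: "\<forall>k. k + t \<in> L \<longleftrightarrow> k \<in> L"
  have "F 0 + G 0 + t \<in> L" using t grid_mem by blast
  then obtain A B where AB: "F 0 + G 0 + t = F A + G B" by (auto simp: L_eq)
  \<comment> \<open>Injectivity of \<open>s\<close> allows a coincidence with a translated position
    to be moved by one step in either direction.\<close>
  have s_eq: "F a + G b + t = F a' + G b' \<longleftrightarrow> F (a + 1) + G b + t = F (a' + 1) + G b'" for a b a' b'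
    using inj_on_eq_iff[OF inj_s, of "F a + G b + t" "F a' + G b'"] t s_shift[of t "F a + G b"]
    by (simp add: s_grid)
  have c_eq: "F a + G b + t = F a' + G b' \<longleftrightarrow> F a + G (b + 1) + t = F a' + G (b' + 1)" for a b a' b'
    using inj_on_eq_iff[OF inj_c, of "F a + G b + t" "F a' + G b'"] t c_shift[of t "F a + G b"]
    by (simp add: c_grid)
  have F: "F a + G 0 + t = F (a + A) + G B" for a
  proof (rule int_induct_iff[where j = 0 and P = "\<lambda>a. F a + G 0 + t = F (a + A) + G B"])
    show "F i + G 0 + t = F (i + A) + G B \<longleftrightarrow> F (i + 1) + G 0 + t = F (i + 1 + A) + G B" for i
      using s_eq[of i 0 "i + A" B] by (simp add: ac_simps)
  qed (use AB in simp)
  have G: "F 0 + G b + t = F A + G (b + B)" for b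
  proof (rule int_induct_iff[where j = 0 and P = "\<lambda>b. F 0 + G b + t = F A + G (b + B)"])
    show "F 0 + G i + t = F A + G (i + B) \<longleftrightarrow> F 0 + G (i + 1) + t = F A + G (i + 1 + B)" for i
      using c_eq[of 0 i A "i + B"] by (simp add: ac_simps)
  qed (use AB in simp)
  have "additive_period F A" unfolding additive_period_def using F AB by (smt (verit))
  moreover have "additive_period G B" unfolding additive_period_def using G AB by (smt (verit))
  ultimately show "\<exists>A B. additive_period F A \<and> additive_period G B \<and> t = F A - F 0 + (G B - G 0)"
    using AB by (intro exI[of _ A] exI[of _ B]) simp
qed

text \<open>For a tape, \<open>period_F\<close> and \<open>period_G\<close> will be the lengths of
  the roots P and Q, and \<open>shift_F\<close> and \<open>shift_G\<close> the numbers p and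
  q.\<close>

definition period_F :: nat where "period_F = least_additive_period F"
definition period_G :: nat where "period_G = least_additive_period G"
definition shift_F :: int where "shift_F = F (int period_F) - F 0"
definition shift_G :: int where "shift_G = G (int period_G) - G 0"

lemma F_mult: "F (a + m * int period_F) = F a + m * shift_F"
  unfolding shift_F_def period_F_def
  by (rule additive_period_mult) (simp add: least_period_F)

lemma G_mult: "G (b + m * int period_G) = G b + m * shift_G"
  unfolding shift_G_def period_G_def
  by (rule additive_period_mult) (simp add: step_grid.least_period_F[OF swap])

lemma shift_pos: "0 < shift_F" "0 < shift_G"
  unfolding shift_F_def shift_G_def period_F_def period_G_def
  using F_strict_mono[of 0] least_period_F(1) step_grid.F_strict_mono[OF swap, of 0]
    step_grid.least_period_F(1)[OF swap] by simp_all

text \<open>Additive periods are multiples of the least ones, so the symmetries are the integer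
  combinations of p and q, which by Bezout are the multiples of their gcd.\<close>

lemma least_translation:
  "int (LEAST l. 0 < l \<and> (\<forall>k. k + int l \<in> L \<longleftrightarrow> k \<in> L)) = gcd shift_F shift_G"
proof -
  have "(\<forall>k. k + t \<in> L \<longleftrightarrow> k \<in> L) \<longleftrightarrow> gcd shift_F shift_G dvd t" for t
  proof -
    have "(\<forall>k. k + t \<in> L \<longleftrightarrow> k \<in> L) \<longleftrightarrow> (\<exists>x y. t = x * shift_F + y * shift_G)"
    proof
      assume "\<forall>k. k + t \<in> L \<longleftrightarrow> k \<in> L"
      then obtain x y where "t = F (int period_F * x) - F 0 + (G (int period_G * y) - G 0)"
        unfolding translation_iff least_period_F(2) step_grid.least_period_F(2)[OF swap]
        by (auto simp: period_F_def period_G_def elim!: dvdE)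
      then have "t = x * shift_F + y * shift_G"
        using F_mult[of 0 x] G_mult[of 0 y] by (simp add: ac_simps)
      then show "\<exists>x y. t = x * shift_F + y * shift_G" by blast
    next
      assume "\<exists>x y. t = x * shift_F + y * shift_G"
      then obtain x y where "t = x * shift_F + y * shift_G" by blast
      then have "t = F (x * int period_F) - F 0 + (G (y * int period_G) - G 0)"
        using F_mult[of 0 x] G_mult[of 0 y] by simp
      then show "\<forall>k. k + t \<in> L \<longleftrightarrow> k \<in> L"
        unfolding translation_iff least_period_F(2) step_grid.least_period_F(2)[OF swap]
        by (intro exI[of _ "x * int period_F"] exI[of _ "y * int period_G"])
          (simp add: period_F_def period_G_def)
    qed
    also have "\<dots> \<longleftrightarrow> gcd shift_F shift_G dvd t"
    proof
      assume "gcd shift_F shift_G dvd t"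
      then obtain m where m: "t = gcd shift_F shift_G * m" ..
      obtain u v where "u * shift_F + v * shift_G = gcd shift_F shift_G" using bezout_int by blast
      then have "t = (m * u) * shift_F + (m * v) * shift_G" by (simp add: m algebra_simps flip: distrib_left)
      then show "\<exists>x y. t = x * shift_F + y * shift_G" by blast
    qed auto
    finally show ?thesis .
  qed
  moreover have "(LEAST l. 0 < l \<and> gcd shift_F shift_G dvd int l) = nat (gcd shift_F shift_G)"
  proof (rule Least_equality)
    show "0 < nat (gcd shift_F shift_G) \<and> gcd shift_F shift_G dvd int (nat (gcd shift_F shift_G))"
      using shift_pos by simp
  qed (auto dest: zdvd_imp_le)
  ultimately show ?thesis by simp
qed

section \<open>The scale in terms of the degrees\<close>

lemma scale_eq_deg:
  "F (a + int (card (orbits L c))) - F a = int (card (orbits L c) div period_F) * shift_F"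
  using F_mult[of a "int (card (orbits L c) div period_F)"] additive_period_card_orbits
  by (simp add: least_period_F(2) period_F_def flip: of_nat_mult)

lemma scale_eq_codeg:
  "G (b + int (card (orbits L s))) - G b = int (card (orbits L s) div period_G) * shift_G"
  using G_mult[of b "int (card (orbits L s) div period_G)"]
    step_grid.additive_period_card_orbits[OF swap]
  by (simp add: step_grid.least_period_F(2)[OF swap] period_G_def flip: of_nat_mult)

text \<open>Dividing \<open>d * shift_F = e * shift_G\<close> by \<open>gcd d e\<close> gives a
  collision with first coordinate \<open>d' * period_F\<close>. This is a multiple of \<beta>, yet
  \<beta> is \<open>gcd d e\<close> times it, so the gcd is 1.\<close>

lemma coprime_degs:
  "coprime (card (orbits L c) div period_F) (card (orbits L s) div period_G)"
proof -
  define d e where "d = int (card (orbits L c) div period_F)"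
    and "e = int (card (orbits L s) div period_G)"
  obtain d' e' where d': "d = gcd d e * d'" and e': "e = gcd d e * e'"
    by (meson dvdE gcd_dvd1 gcd_dvd2)
  have card: "int (card (orbits L c)) = d * int period_F"
    using additive_period_card_orbits
    by (simp add: d_def period_F_def least_period_F(2) flip: of_nat_mult)
  then have "d \<noteq> 0" using card_c_orbits(1) by auto
  have "d * shift_F = e * shift_G"
    using scale_eq[of 0 0] unfolding scale_eq_deg scale_eq_codeg d_def e_def .
  then have "gcd d e * (d' * shift_F) = gcd d e * (e' * shift_G)"
    using d' e' by (metis mult.assoc)
  then have "d' * shift_F = e' * shift_G" using \<open>d \<noteq> 0\<close> by simp
  then have "F (0 + d' * int period_F) + G (0 + - e' * int period_G) = F 0 + G 0"
    unfolding F_mult G_mult by simp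
  then have "int (card (orbits L c)) dvd d' * int period_F"
    using collisionI card_c_orbits(2) by blast
  then have "gcd d e * (d' * int period_F) dvd d' * int period_F"
    using card d' by (metis mult.assoc)
  moreover have "d' * int period_F \<noteq> 0"
    using card card_c_orbits(1) d' by (metis mult.assoc mult_zero_right of_nat_0_eq_iff not_gr_zero)
  ultimately have "gcd d e dvd 1"
    by (metis dvd_mult_cancel_right mult_1)
  then have "coprime d e" by (simp add: coprime_iff_gcd_eq_1)
  then show ?thesis by (simp add: d_def e_def)
qed

text \<open>Let S be the common value \<open>d * shift_F = e * shift_G\<close>. Multiplying the gcd
  of the shifts by \<open>d * e\<close> gives the gcd of \<open>e\<close> S and \<open>d\<close> S,
  which is S by coprimality.\<close>

lemma gcd_shift_eq_scale:
  "gcd shift_F shift_G *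
     (int (card (orbits L c) div period_F) * int (card (orbits L s) div period_G)) =
   F (a + int (card (orbits L c))) - F a"
proof -
  define d e where "d = int (card (orbits L c) div period_F)"
    and "e = int (card (orbits L s) div period_G)"
  have eq: "d * shift_F = e * shift_G"
    using scale_eq[of 0 0] unfolding scale_eq_deg scale_eq_codeg d_def e_def .
  have "coprime e d" using coprime_degs by (simp add: d_def e_def coprime_commute)
  have "0 \<le> d * e" "0 \<le> d" by (simp_all add: d_def e_def)
  then have "gcd shift_F shift_G * (d * e) = gcd (d * e * shift_F) (d * e * shift_G)"
    using gcd_mult_distrib_int[of "d * e" shift_F shift_G] by (simp only: abs_of_nonneg mult.commute)
  also have "\<dots> = gcd (e * (d * shift_F)) (d * (e * shift_G))"
    by (simp only: ac_simps)
  also have "\<dots> = gcd (d * shift_F * e) (d * shift_F * d)"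
    unfolding eq by (simp only: mult.commute)
  also have "\<dots> = d * shift_F"
    using \<open>coprime e d\<close> \<open>0 \<le> d\<close> shift_pos
      gcd_mult_distrib_int[of "d * shift_F" e d] by (simp add: abs_mult)
  finally show ?thesis by (simp add: scale_eq_deg d_def e_def)
qed

end

section \<open>Tapes satisfying the local toggle rule\<close>

text \<open>Position \<open>k - n\<close> holds the old value of the toggled entry, while
  \<open>k - 1\<close> and \<open>k - n + 1\<close> hold its two neighbours at the moment of the
  toggle. The same formula holds across row boundaries, so the tape can be studied without
  rows.\<close>

locale tape_rule =
  fixes n :: nat and X :: "int \<Rightarrow> bool"
  assumes two_le: "2 \<le> n"
    and rule: "X k \<longleftrightarrow> \<not> X (k - 1) \<and> \<not> X (k - int n + 1) \<and> \<not> X (k - int n)"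
begin

abbreviation s where "s \<equiv> successor n X"
abbreviation c where "c \<equiv> cosuccessor n X"

lemma dead_near_live:
  assumes "X k"
  shows "\<not> X (k + 1)" "\<not> X (k - 1)" "\<not> X (k + int n)" "\<not> X (k - int n)"
    "\<not> X (k + int n - 1)" "\<not> X (k - int n + 1)"
  using assms rule[of k] rule[of "k + 1"] rule[of "k + int n"] rule[of "k + int n - 1"] by auto

text \<open>In the rule at \<open>k + n + 1\<close>, a live \<open>k\<close> makes
  \<open>k + 1\<close> and \<open>k + n\<close> dead, which leaves \<open>k + 2\<close> as the only
  obstacle.\<close>

lemma successor_cases:
  assumes "X k"
  obtains (E) "X (k + 2)" "s k = k + 2"
  | (D) "\<not> X (k + 2)" "X (k + int n + 1)" "s k = k + int n + 1"
proof -
  have *: "X (k + int n + 1) \<longleftrightarrow> \<not> X (k + 2)"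
    using rule[of "k + int n + 1"] dead_near_live[OF assms] by (simp add: algebra_simps)
  show ?thesis
  proof (cases "X (k + 2)")
    case True
    with * have "s k = k + 2"
      unfolding successor_def live_def by (intro the_equality) auto
    with True show ?thesis by (rule E)
  next
    case False
    with * have "s k = k + int n + 1"
      unfolding successor_def live_def by (intro the_equality) auto
    with False * show ?thesis by (intro D) auto
  qed
qed

text \<open>In the rule at \<open>k + 2n - 1\<close>, a live \<open>k\<close> makes
  \<open>k + n\<close> and \<open>k + n - 1\<close> dead, which leaves
  \<open>k + 2n - 2\<close>.\<close>

lemma cosuccessor_cases:
  assumes "X k"
  obtains (L) "X (k + 2 * int n - 2)" "\<not> X (k + 2 * int n - 1)" "c k = k + 2 * int n - 2"
  | (S) "\<not> X (k + 2 * int n - 2)" "X (k + 2 * int n - 1)" "c k = k + 2 * int n - 1"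
proof -
  have *: "X (k + 2 * int n - 1) \<longleftrightarrow> \<not> X (k + 2 * int n - 2)"
    using rule[of "k + 2 * int n - 1"] dead_near_live[OF assms] by (simp add: algebra_simps)
  show ?thesis
  proof (cases "X (k + 2 * int n - 2)")
    case True
    with * have "c k = k + 2 * int n - 2"
      unfolding cosuccessor_def live_def by (intro the_equality) auto
    with True * show ?thesis by (intro L) auto
  next
    case False
    with * have "c k = k + 2 * int n - 1"
      unfolding cosuccessor_def live_def by (intro the_equality) auto
    with False * show ?thesis by (intro S) auto
  qed
qed

lemma live_steps:
  assumes "X k"
  shows "X (s k)" "X (c k)" "k < s k" "k < c k" "s k \<le> k + 2 * int n" "c k \<le> k + 2 * int n"
  using two_le by (auto intro: successor_cases[OF assms] cosuccessor_cases[OF assms])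

lemma successor_eqI:
  assumes "X k" "X j" "j = k + 2 \<or> j = k + int n + 1"
  shows "s k = j"
proof -
  have excl: "\<not> (X (k + 2) \<and> X (k + int n + 1))"
    using dead_near_live(5)[of "k + 2"] by (auto simp: algebra_simps)
  show ?thesis by (rule successor_cases[OF \<open>X k\<close>]) (use assms excl in auto)
qed

lemma cosuccessor_eqI:
  assumes "X k" "X j" "j = k + 2 * int n - 2 \<or> j = k + 2 * int n - 1"
  shows "c k = j"
  by (rule cosuccessor_cases[OF \<open>X k\<close>]) (use assms dead_near_live(1) in auto)

text \<open>It suffices that the fourth corner \<open>c k + (s k - k)\<close> is live: it lies at a
  successor distance from \<open>c k\<close> and at a co-successor distance from
  \<open>s k\<close>.\<close>

lemma steps_commute:
  assumes "X k"
  shows "s (c k) = c k + (s k - k)" "c (s k) = c k + (s k - k)"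
proof -
  have "X (c k + (s k - k))"
    using assms
  proof (cases rule: successor_cases)
    case E
    note dead = dead_near_live[OF assms] dead_near_live[OF E(1)]
    from assms show ?thesis
    proof (cases rule: cosuccessor_cases)
      case L
      \<comment> \<open>All three entries in the rule at \<open>k + 2n\<close> are dead:
        \<open>k + 2n - 1\<close> is next to the live \<open>k + 2n - 2\<close>,
        \<open>k + n + 1\<close> is killed by \<open>k + 2\<close>, and \<open>k + n\<close> by
        \<open>k\<close>.\<close>
      then have "X (k + 2 * int n)"
        using rule[of "k + 2 * int n"] dead by (auto simp: algebra_simps)
      then show ?thesis using E L by (simp add: algebra_simps)
    next
      case S
      have eq: "c k + (s k - k) = k + 2 * int n + 1" using E(2) S(3) by simp
      have not_L: "\<not> X (k + 2 * int n)" using dead_near_live(1)[OF S(2)] by simp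
      have "X (s k)" using E by simp
      then have "X (k + 2 * int n + 1)"
        by (cases rule: cosuccessor_cases) (use E(2) not_L in \<open>simp_all add: algebra_simps\<close>)
      then show ?thesis unfolding eq .
    qed
  next
    case D
    have "X (c k)" using live_steps assms by simp
    then show ?thesis
    proof (cases rule: successor_cases)
      case E
      \<comment> \<open>Both candidates are killed by the live \<open>k + n + 1\<close>, so type D
        at \<open>k\<close> excludes type E at \<open>c k\<close>.\<close>
      have "c k + 2 \<in> {k + 2 * int n, k + 2 * int n + 1}"
        by (auto intro: cosuccessor_cases[OF assms])
      moreover have "\<not> X (k + 2 * int n)" "\<not> X (k + 2 * int n + 1)"
        using dead_near_live(3,5)[OF D(2)] by (simp_all add: algebra_simps)
      ultimately have False using E(1) by (metis insertE singletonD)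
      then show ?thesis ..
    qed (use D in \<open>simp add: algebra_simps\<close>)
  qed
  note X = this
  have "s k - k \<in> {2, int n + 1}" "c k - k \<in> {2 * int n - 2, 2 * int n - 1}"
    by (auto intro: successor_cases[OF assms] cosuccessor_cases[OF assms])
  with X live_steps assms show "s (c k) = c k + (s k - k)" "c (s k) = c k + (s k - k)"
    by (auto intro!: successor_eqI cosuccessor_eqI)
qed

section \<open>Bijectivity and joint transitivity of the step maps\<close>

lemma predecessor_exists:
  assumes "X k"
  obtains j where "X j" "s j = k" "j = k - 2 \<or> j = k - int n - 1"
proof -
  \<comment> \<open>Since \<open>k - 1\<close> is dead, some entry in its rule is live, and
    \<open>k - n\<close> is killed by \<open>k\<close>.\<close>
  have "X (k - 2) \<or> X (k - int n - 1)"
    using rule[of "k - 1"] dead_near_live[OF assms] by (auto simp: algebra_simps)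
  then show ?thesis
    using that[of "k - 2"] that[of "k - int n - 1"] assms
      successor_eqI[of "k - 2" k] successor_eqI[of "k - int n - 1" k] by auto
qed

lemma copredecessor_exists:
  assumes "X k"
  obtains j where "X j" "c j = k"
proof -
  \<comment> \<open>Since \<open>k - n + 1\<close> is dead, some entry in its rule is live, and
    \<open>k - n\<close> is killed by \<open>k\<close>.\<close>
  have "X (k - 2 * int n + 2) \<or> X (k - 2 * int n + 1)"
    using rule[of "k - int n"] rule[of "k - int n + 1"] dead_near_live[OF assms]
      dead_near_live[of "k - 2 * int n"]
    by (auto simp: algebra_simps)
  then show ?thesis
    using that[of "k - 2 * int n + 2"] that[of "k - 2 * int n + 1"] assms
      cosuccessor_eqI[of "k - 2 * int n + 2" k] cosuccessor_eqI[of "k - 2 * int n + 1" k] by auto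
qed

text \<open>A common image under steps of different types would give two live positions at distance
  \<open>n - 1\<close>.\<close>

lemma inj_successor: "inj_on s (live X)"
proof (rule inj_onI)
  fix j k assume "j \<in> live X" "k \<in> live X" "s j = s k"
  then have "X j" "X k" "s j = s k" by (simp_all add: live_def)
  from \<open>X j\<close> show "j = k"
  proof (cases rule: successor_cases)
    case E
    from \<open>X k\<close> show ?thesis
    proof (cases rule: successor_cases)
      case D
      then have "j = k + int n - 1" using E \<open>s j = s k\<close> by simp
      then show ?thesis using dead_near_live[OF \<open>X k\<close>] \<open>X j\<close> by simp
    qed (use E \<open>s j = s k\<close> in simp)
  next
    case D
    from \<open>X k\<close> show ?thesis
    proof (cases rule: successor_cases)
      case E
      then have "k = j + int n - 1" using D \<open>s j = s k\<close> by simp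
      then show ?thesis using dead_near_live[OF \<open>X j\<close>] \<open>X k\<close> by simp
    qed (use D \<open>s j = s k\<close> in simp)
  qed
qed

lemma inj_cosuccessor: "inj_on c (live X)"
proof (rule inj_onI)
  fix j k assume "j \<in> live X" "k \<in> live X" "c j = c k"
  then have "X j" "X k" "c j = c k" by (simp_all add: live_def)
  have "c j - j \<in> {2 * int n - 2, 2 * int n - 1}" "c k - k \<in> {2 * int n - 2, 2 * int n - 1}"
    by (auto intro: cosuccessor_cases[OF \<open>X j\<close>] cosuccessor_cases[OF \<open>X k\<close>])
  then have "j = k \<or> j = k + 1 \<or> j = k - 1" using \<open>c j = c k\<close> by auto
  then show "j = k" using dead_near_live[OF \<open>X k\<close>] \<open>X j\<close> by auto
qed

lemma bij_successor: "bij_betw s (live X) (live X)"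
  using inj_successor live_steps
  by (auto simp: bij_betw_def live_def image_iff) (metis predecessor_exists)

lemma bij_cosuccessor: "bij_betw c (live X) (live X)"
  using inj_cosuccessor live_steps
  by (auto simp: bij_betw_def live_def image_iff) (metis copredecessor_exists)

text \<open>
  If neither \<open>k + 2\<close> nor \<open>k' - 2\<close> is live, then \<open>s k = k + n + 1\<close> and \<open>k' = s j\<close> for
  \<open>j = k' - n - 1\<close>, so \<open>c j\<close> is \<open>k' + n - 3\<close> or \<open>k' + n - 2\<close> and the gap from
  \<open>s k\<close> to \<open>c j\<close> is smaller than the gap from \<open>k\<close> to \<open>k'\<close>.
\<close>

lemma live_transitive:
  assumes R: "\<And>k. X k \<Longrightarrow> R (s k) \<longleftrightarrow> R k" "\<And>k. X k \<Longrightarrow> R (c k) \<longleftrightarrow> R k"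
    and "X k" "X k'"
  shows "R k \<longleftrightarrow> R k'"
proof -
  have *: "R k \<longleftrightarrow> R k'" if "X k" "X k'" "k \<le> k'" for k k'
    using that
  proof (induction "nat (k' - k)" arbitrary: k k' rule: less_induct)
    case less
    obtain j where j: "X j" "s j = k'" "j = k' - 2 \<or> j = k' - int n - 1"
      using predecessor_exists \<open>X k'\<close> by metis
    consider "k' = k" | "k' = k + 1" | "k' \<ge> k + 2" using \<open>k \<le> k'\<close> by linarith
    then show ?case
    proof cases
      case 3
      from \<open>X k\<close> show ?thesis
      proof (cases rule: successor_cases)
        case E
        have "R (k + 2) \<longleftrightarrow> R k'" by (rule less.hyps) (use E 3 less.prems in auto)
        then show ?thesis using R(1)[OF \<open>X k\<close>] E by simp
      next
        case D
        from j(3) show ?thesis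
        proof
          assume "j = k' - 2"
          then have "R k \<longleftrightarrow> R j" by (intro less.hyps) (use j 3 less.prems in auto)
          then show ?thesis using R(1)[OF \<open>X j\<close>] j by simp
        next
          assume j_eq: "j = k' - int n - 1"
          have "k' \<noteq> k + 2" using D less.prems by auto
          have c: "c j = k' + int n - 3 \<or> c j = k' + int n - 2"
            using \<open>X j\<close> by (cases rule: cosuccessor_cases) (use j_eq in auto)
          \<comment> \<open>The new gap \<open>c j - s k\<close> is at least -1 because
            \<open>k' - k\<close> is at least 3; the value -1 would make neighbouring positions
            live.\<close>
          have "c j \<noteq> s k - 1"
            using live_steps[OF \<open>X j\<close>] dead_near_live[of "s k"] live_steps[OF \<open>X k\<close>] by auto
          then have "R (s k) \<longleftrightarrow> R (c j)"
            by (intro less.hyps)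
              (use c 3 \<open>k' \<noteq> k + 2\<close> D live_steps[OF \<open>X j\<close>] live_steps[OF \<open>X k\<close>] in auto)
          then show ?thesis using R j \<open>X k\<close> by metis
        qed
      qed
    qed (use dead_near_live[OF \<open>X k\<close>] less.prems in auto)
  qed
  show ?thesis using *[of k k'] *[of k' k] assms(3,4) by linarith
qed

section \<open>Grid coordinates for the live positions\<close>

lemma live_nonempty: "\<exists>k. X k"
  using rule by blast

text \<open>As step types persist along the other map, \<open>a\<close> successor steps from
  \<open>k\<close> and from \<open>c k\<close> cover the same distance. This makes the coordinates
  additive.\<close>

lemma cosuccessor_int_iterate:
  assumes "X k"
  shows "int_iterate (live X) s a (c k) = c k + (int_iterate (live X) s a k - k)"
    "int_iterate (live X) s a (c k) = c (int_iterate (live X) s a k)"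
proof -
  have k: "k \<in> live X" "c k \<in> live X" using assms live_steps by (simp_all add: live_def)
  note it = int_iterate_simps[OF bij_successor k(1)] int_iterate_simps[OF bij_successor k(2)]
  have comm: "int_iterate (live X) s a (c k) = c (int_iterate (live X) s a k)" for a
  proof (rule int_induct_iff[where j = 0 and
      P = "\<lambda>a. int_iterate (live X) s a (c k) = c (int_iterate (live X) s a k)"])
    fix a
    let ?y = "int_iterate (live X) s a k"
    have "X ?y" using it(2) by (simp add: live_def)
    then have "c (s ?y) = s (c ?y)" "c ?y \<in> live X"
      using steps_commute live_steps by (simp_all add: live_def)
    then show "int_iterate (live X) s a (c k) = c ?y \<longleftrightarrow>
        int_iterate (live X) s (a + 1) (c k) = c (int_iterate (live X) s (a + 1) k)"
      using inj_on_eq_iff[OF inj_successor it(5)] by (simp add: it)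
  qed (simp add: it)
  show "int_iterate (live X) s a (c k) = c k + (int_iterate (live X) s a k - k)"
  proof (rule int_induct_iff[where j = 0 and
      P = "\<lambda>a. int_iterate (live X) s a (c k) = c k + (int_iterate (live X) s a k - k)"])
    fix a
    have "X (int_iterate (live X) s a k)" using it(2) by (simp add: live_def)
    from steps_commute[OF this]
    show "int_iterate (live X) s a (c k) = c k + (int_iterate (live X) s a k - k) \<longleftrightarrow>
        int_iterate (live X) s (a + 1) (c k) = c k + (int_iterate (live X) s (a + 1) k - k)"
      by (auto simp: it comm)
  qed (simp add: it)
  show "int_iterate (live X) s a (c k) = c (int_iterate (live X) s a k)" by (rule comm)
qed

lemma step_grid_exists: "\<exists>F G. step_grid (live X) s c F G (2 * int n)"
proof -
  obtain k0 where "X k0" using live_nonempty by blast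
  \<comment> \<open>The base point is carried by \<open>G\<close> alone; \<open>F\<close> measures
    displacements, with \<open>F 0 = 0\<close>.\<close>
  define G where "G b = int_iterate (live X) c b k0" for b
  define F where "F a = int_iterate (live X) s a k0 - k0" for a
  have k0: "k0 \<in> live X" using \<open>X k0\<close> by (simp add: live_def)
  note itc = int_iterate_simps[OF bij_cosuccessor k0]
  have G: "X (G b)" "G (b + 1) = c (G b)" "G 0 = k0" for b
    using itc by (simp_all add: G_def live_def)
  have sF: "int_iterate (live X) s a (G b) = F a + G b" for a b
  proof (rule int_induct_iff[where j = 0 and
      P = "\<lambda>b. int_iterate (live X) s a (G b) = F a + G b"])
    show "int_iterate (live X) s a (G b) = F a + G b \<longleftrightarrow>
        int_iterate (live X) s a (G (b + 1)) = F a + G (b + 1)" for b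
      using cosuccessor_int_iterate(1)[OF G(1)[of b]] by (auto simp: G(2))
  qed (simp add: G(3) F_def)
  have it: "X (F a + G b)" "s (F a + G b) = F (a + 1) + G b" for a b
    using int_iterate_simps[OF bij_successor, of "G b"] G(1)
    unfolding sF[symmetric] by (simp_all add: live_def)
  have c: "c (F a + G b) = F a + G (b + 1)" for a b
    using sF[of a b] sF[of a "b + 1"] cosuccessor_int_iterate(2)[OF G(1), of a b] G(2)[of b]
    by simp
  have bounds: "F a < F (a + 1)" "F (a + 1) \<le> F a + 2 * int n"
    "G b < G (b + 1)" "G (b + 1) \<le> G b + 2 * int n" for a b
    using live_steps[OF it(1)[of a b]] unfolding it(2) c by simp_all
  have "k \<in> {F a + G b | a b. True}" if "X k" for k
  proof -
    \<comment> \<open>Lying on the grid is invariant under both step maps in both directions, so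
      transitivity extends it to all live positions.\<close>
    let ?R = "\<lambda>k. k \<in> {F a + G b | a b. True}"
    have "?R (s k) \<longleftrightarrow> ?R k" if "X k" for k
    proof
      assume "?R (s k)"
      then obtain a b where "s k = s (F (a - 1) + G b)" by (auto simp: it)
      then have "k = F (a - 1) + G b"
        using inj_onD[OF inj_successor] that it(1) by (auto simp: live_def)
      then show "?R k" by blast
    qed (use it(2) in fastforce)
    moreover have "?R (c k) \<longleftrightarrow> ?R k" if "X k" for k
    proof
      assume "?R (c k)"
      then obtain a b where "c k = c (F a + G (b - 1))" by (auto simp: c)
      then have "k = F a + G (b - 1)"
        using inj_onD[OF inj_cosuccessor] that it(1) by (auto simp: live_def)
      then show "?R k" by blast
    qed (use c in fastforce)
    moreover have "?R (F 0 + G 0)" by blast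
    ultimately show ?thesis
      using live_transitive[of ?R, OF _ _ it(1)[of 0 0] that] by blast
  qed
  then have "live X = {F a + G b | a b. True}" using it(1) by (auto simp: live_def)
  then have "step_grid (live X) s c F G (2 * int n)"
  proof (unfold_locales)
    fix t k assume t: "\<And>k. k + t \<in> live X \<longleftrightarrow> k \<in> live X" and "k \<in> live X"
    then have k: "X (k + t)" "X k" and Xt: "\<And>k. X (k + t) \<longleftrightarrow> X k" by (simp_all add: live_def)
    have "s k - k \<in> {2, int n + 1}" "c k - k \<in> {2 * int n - 2, 2 * int n - 1}"
      by (auto intro: successor_cases[OF \<open>X k\<close>] cosuccessor_cases[OF \<open>X k\<close>])
    then show "s (k + t) = s k + t" "c (k + t) = c k + t"
      using live_steps[OF \<open>X k\<close>] k Xt by (auto intro!: successor_eqI cosuccessor_eqI)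
  qed (use it c bounds inj_successor inj_cosuccessor in auto)
  then show ?thesis by blast
qed

section \<open>From the grid to the invariants of the tape\<close>

lemma common_value_eq:
  assumes "\<And>k. X k \<Longrightarrow> f k = v"
  shows "common_value X f = v"
  unfolding common_value_def using assms live_nonempty by (auto simp: live_def)

text \<open>In coordinates the slither involves only \<open>F\<close> and the co-slither only
  \<open>G\<close>, so the grid results apply to both. Positivity of the degrees permits the final
  division.\<close>

lemma period_formula:
  shows "int (tape_period X) = gcd (slither_shift n X) (coslither_shift n X)"
    "int (tape_period X) * (int (tape_deg n X) * int (tape_codeg n X)) = tape_scale n X"
    "0 < tape_deg n X" "0 < tape_codeg n X"
proof -
  obtain F G where grid: "step_grid (live X) s c F G (2 * int n)" using step_grid_exists by blast
  interpret g: step_grid "live X" s c F G "2 * int n" by (rule grid)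
  interpret sw: step_grid "live X" c s G F "2 * int n" by (rule g.swap)
  define \<beta> \<alpha> where "\<beta> = num_cosnakes n X" and "\<alpha> = num_snakes n X"
  have \<beta>: "\<beta> = card (orbits (live X) c)" and \<alpha>: "\<alpha> = card (orbits (live X) s)"
    by (simp_all add: \<beta>_def \<alpha>_def num_cosnakes_def num_snakes_def snakes_def cosnakes_def)
  have pos: "0 < \<beta>" "0 < \<alpha>" using g.card_c_orbits(1) g.card_s_orbits(1) by (simp_all add: \<beta> \<alpha>)
  have coord: "\<exists>a b. k = F a + G b" if "X k" for k using that g.L_eq by (auto simp: live_def)
  have X: "X (F a + G b)" for a b using g.grid_mem by (simp add: live_def)

  \<comment> \<open>\<open>h\<close> and \<open>h'\<close> read the letter of a step off its length;
    \<open>h\<close> separates 2 from \<open>n + 1\<close> because \<open>n\<close> is at least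
    2.\<close>
  define h where "h d = (if d = 2 then Step_E else Step_D)" for d :: int
  define h' where "h' d = (if d = 2 * int n - 1 then Step_S else Step_L)" for d :: int
  have steps: "F (i + 1) - F i \<in> {2, int n + 1}" "G (i + 1) - G i \<in> {2 * int n - 2, 2 * int n - 1}" for i
    using g.s_grid[of i 0] g.c_grid[of 0 i]
    by (auto intro: successor_cases[OF X[of i 0]] cosuccessor_cases[OF X[of 0 i]])
  have inj: "inj_on h (range (\<lambda>i. F (i + 1) - F i))"
    by (rule inj_on_subset[of h "{2, int n + 1}"])
      (use steps two_le in \<open>auto simp: inj_on_def h_def\<close>)
  have inj': "inj_on h' (range (\<lambda>i. G (i + 1) - G i))"
    by (rule inj_on_subset[of h' "{2 * int n - 2, 2 * int n - 1}"])
      (use steps in \<open>auto simp: inj_on_def h'_def\<close>)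
  have slither: "slither n X (F a + G b) =
      map (\<lambda>i. h (F (a + int i + 1) - F (a + int i))) [0..<\<beta>]" for a b
    by (auto simp: slither_def \<beta>_def g.s_funpow step_type_of_def g.s_grid h_def)
  have cow: "(c ^^ i) (F a + G b) = F a + G (b + int i)" for i a b
    using sw.s_funpow[of i b a] by (simp add: add.commute)
  have coslither: "coslither n X (F a + G b) =
      map (\<lambda>i. h' (G (b + int i + 1) - G (b + int i))) [0..<\<alpha>]" for a b
    by (auto simp: coslither_def \<alpha>_def cow costep_type_of_def g.c_grid h'_def)
  have F_words: "length (slither n X (F a + G b)) div cyclic_period (slither n X (F a + G b)) = \<beta> div g.period_F"
    "word_root (\<beta> div g.period_F) (slither n X (F a + G b)) = take g.period_F (slither n X (F a + G b))"
    "length (take g.period_F (slither n X (F a + G b))) = g.period_F" for a b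
    unfolding slither g.period_F_def
    by (rule cyclic_period_steps(2-4)[OF g.additive_period_card_orbits[folded \<beta>] pos(1) inj])+
  have G_words: "length (coslither n X (F a + G b)) div cyclic_period (coslither n X (F a + G b)) = \<alpha> div g.period_G"
    "word_root (\<alpha> div g.period_G) (coslither n X (F a + G b)) = take g.period_G (coslither n X (F a + G b))"
    "length (take g.period_G (coslither n X (F a + G b))) = g.period_G" for a b
    unfolding coslither g.period_G_def
    by (rule cyclic_period_steps(2-4)[OF sw.additive_period_card_orbits[folded \<alpha>] pos(2) inj'])+
  have deg: "tape_deg n X = \<beta> div g.period_F"
    unfolding tape_deg_def
    by (rule common_value_eq) (use coord F_words(1) in blast)
  have codeg: "tape_codeg n X = \<alpha> div g.period_G"
    unfolding tape_codeg_def
    by (rule common_value_eq) (use coord G_words(1) in blast)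
  have "slither_shift n X = g.shift_F"
    unfolding slither_shift_def
  proof (rule common_value_eq)
    fix k assume "X k"
    then obtain a b where k: "k = F a + G b" using coord by blast
    show "(s ^^ length (word_root (tape_deg n X) (slither n X k))) k - k = g.shift_F"
      unfolding k deg F_words(2,3) g.s_funpow using g.F_mult[of a 1] by simp
  qed
  moreover have "coslither_shift n X = g.shift_G"
    unfolding coslither_shift_def
  proof (rule common_value_eq)
    fix k assume "X k"
    then obtain a b where k: "k = F a + G b" using coord by blast
    show "(c ^^ length (word_root (tape_codeg n X) (coslither n X k))) k - k = g.shift_G"
      unfolding k codeg G_words(2,3) cow using g.G_mult[of b 1] by simp
  qed
  moreover have T: "int (tape_period X) = gcd g.shift_F g.shift_G"
    using g.least_translation by (simp add: tape_period_def live_def)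
  ultimately show "int (tape_period X) = gcd (slither_shift n X) (coslither_shift n X)" by simp
  have "tape_scale n X = F (0 + int \<beta>) - F 0"
    unfolding tape_scale_def \<beta>_def[symmetric] \<alpha>_def[symmetric]
  proof (rule the_equality)
    show "\<forall>k\<in>live X. (s ^^ \<beta>) k - k = F (0 + int \<beta>) - F 0 \<and>
        (c ^^ \<alpha>) k - k = F (0 + int \<beta>) - F 0"
    proof
      fix k assume "k \<in> live X"
      then obtain a b where k: "k = F a + G b" using coord[of k] by (auto simp: live_def)
      show "(s ^^ \<beta>) k - k = F (0 + int \<beta>) - F 0 \<and> (c ^^ \<alpha>) k - k = F (0 + int \<beta>) - F 0"
        unfolding k g.s_funpow cow
        using g.scale_eq[of a b] g.scale_eq[of 0 b] by (simp add: \<alpha> \<beta>)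
    qed
    then show "d = F (0 + int \<beta>) - F 0"
      if "\<forall>k\<in>live X. (s ^^ \<beta>) k - k = d \<and> (c ^^ \<alpha>) k - k = d" for d
      using that g.grid_mem by metis
  qed
  then show "int (tape_period X) * (int (tape_deg n X) * int (tape_codeg n X)) = tape_scale n X"
    using g.gcd_shift_eq_scale[of 0, folded \<alpha> \<beta>] by (simp only: T deg codeg)
  \<comment> \<open>The scale is positive and is a multiple of each degree, so neither degree is
    0.\<close>
  show "0 < tape_deg n X" "0 < tape_codeg n X"
    using g.scale_eq_deg[of 0, folded \<beta>] g.scale_eq_codeg[of 0, folded \<alpha>]
      g.F_strict_mono[of 0 "int \<beta>"] sw.F_strict_mono[of 0 "int \<alpha>"] pos
    unfolding deg codeg by (auto intro: gr0I)
qed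

end

section \<open>The local rule for ticker tapes\<close>

lemma mem_toggle_other: "j \<noteq> k \<Longrightarrow> j \<in> toggle n k x \<longleftrightarrow> j \<in> x"
  by (simp add: toggle_def)

lemma mem_fold_toggle_other: "j \<notin> set ks \<Longrightarrow> j \<in> fold (toggle n) ks x \<longleftrightarrow> j \<in> x"
  by (induction ks arbitrary: x) (simp_all add: mem_toggle_other)

lemma fold_toggle_independent:
  "x \<in> independent_sets n \<Longrightarrow> fold (toggle n) ks x \<in> independent_sets n"
  by (induction ks arbitrary: x) (simp_all add: toggle_involution)

text \<open>Subtracting 1 turns the congruence into one between numbers that are their own residues,
  except for \<open>n\<close>, whose residue is 0.\<close>

lemma cycle_adjacent_iff:
  assumes "i \<in> {1..int n}" "j \<in> {1..int n}"
  shows "cycle_adjacent n i j \<longleftrightarrow>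
    i = (if j = 1 then int n else j - 1) \<or> i = (if j = int n then 1 else j + 1)"
proof -
  have *: "[a = b + 1] (mod int n) \<longleftrightarrow> a = (if b = int n then 1 else b + 1)"
    if "a \<in> {1..int n}" "b \<in> {1..int n}" for a b
  proof -
    have "[a = b + 1] (mod int n) \<longleftrightarrow> [a - 1 = b] (mod int n)"
      using cong_add_rcancel[of "a - 1" 1 b "int n"] by simp
    also have "\<dots> \<longleftrightarrow> a - 1 = (if b = int n then 0 else b)"
      using that by (auto simp: cong_def)
    finally show ?thesis using that by auto
  qed
  show ?thesis
    unfolding cycle_adjacent_def using *[of i j] *[of j i] assms by auto
qed

text \<open>Just before the toggle at \<open>j\<close>, the entries below \<open>j\<close> already
  have their final values and the others still their initial ones. Later toggles leave entry
  \<open>j\<close> unchanged.\<close>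

lemma mem_tau_iff:
  assumes "2 \<le> n" "y \<in> independent_sets n" "1 \<le> j" "j \<le> int n"
  shows "j \<in> tau n y \<longleftrightarrow> j \<notin> y \<and>
    (if j = 1 then int n \<notin> y else j - 1 \<notin> tau n y) \<and>
    (if j = int n then 1 \<notin> tau n y else j + 1 \<notin> y)"
proof -
  define z where "z = fold (toggle n) [1..j - 1] y"
  have z: "z \<in> independent_sets n" unfolding z_def using assms(2) by (rule fold_toggle_independent)
  have tau: "tau n y = fold (toggle n) [j + 1..int n] (toggle n j z)"
  proof -
    have "[1..int n] = [1..j - 1] @ j # [j + 1..int n]"
      using upto_split1[of 1 j "int n"] upto_rec1[of j "int n"] assms by simp
    then show ?thesis by (simp add: tau_def z_def)
  qed
  have before: "i \<in> z \<longleftrightarrow> i \<in> tau n y" if "i < j" for i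
    using that by (simp add: tau mem_fold_toggle_other mem_toggle_other)
  have after: "i \<in> z \<longleftrightarrow> i \<in> y" if "j \<le> i" for i
    using that by (simp add: z_def mem_fold_toggle_other)
  have "z \<subseteq> {1..int n}" using z by (simp add: independent_sets_def)
  have "insert j z \<in> independent_sets n \<longleftrightarrow> (\<forall>i\<in>z. \<not> cycle_adjacent n i j)" if "j \<notin> z"
  proof -
    have "\<not> cycle_adjacent n j j" using cycle_adjacent_iff[of j n j] assms by auto
    moreover have "cycle_adjacent n i k \<longleftrightarrow> cycle_adjacent n k i" for i k
      by (auto simp: cycle_adjacent_def)
    ultimately show ?thesis using z assms by (auto simp: independent_sets_def)
  qed
  moreover have "(\<forall>i\<in>z. \<not> cycle_adjacent n i j) \<longleftrightarrow>
      (if j = 1 then int n else j - 1) \<notin> z \<and> (if j = int n then 1 else j + 1) \<notin> z"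
    using cycle_adjacent_iff[of _ n j] \<open>z \<subseteq> {1..int n}\<close> assms(3,4) by auto
  moreover have "j \<in> tau n y \<longleftrightarrow> j \<notin> z \<and> insert j z \<in> independent_sets n"
    by (simp add: tau mem_fold_toggle_other toggle_def)
  ultimately show ?thesis
    using before after assms by auto
qed

lemma tape_rule_ticker_tape:
  assumes "2 \<le> n" "x \<in> independent_sets n"
  shows "tape_rule n (ticker_tape n x)"
proof
  show "2 \<le> n" by fact
  fix k
  define y where "y i = int_iterate (independent_sets n) (tau n) i x" for i
  note it = int_iterate_simps[OF bij_betw_tau assms(2)]
  have y: "y i \<in> independent_sets n" "y (i + 1) = tau n (y i)" for i
    using it by (simp_all add: y_def)
  have entry: "ticker_tape n x (i * int n + j) \<longleftrightarrow> j \<in> y i" if "1 \<le> j" "j \<le> int n" for i j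
    using ticker_tape_entry[OF that] by (simp add: y_def)
  \<comment> \<open>The index \<open>i\<close> denotes the row before the one containing
    \<open>k\<close>, so that \<open>k - n\<close> is entry \<open>j\<close> of row
    \<open>i\<close>.\<close>
  define i j where "i = (k - 1) div int n - 1" and "j = (k - 1) mod int n + 1"
  have j: "1 \<le> j" "j \<le> int n" using assms(1) by (simp_all add: j_def add1_zle_eq)
  have k: "k = (i + 1) * int n + j"
    by (simp add: i_def j_def)
  have "ticker_tape n x k \<longleftrightarrow> j \<in> tau n (y i)"
    unfolding k using entry[OF j] y by simp
  moreover have "ticker_tape n x (k - int n) \<longleftrightarrow> j \<in> y i"
    using entry[OF j, of i] by (simp add: k algebra_simps)
  \<comment> \<open>At the row ends the tape supplies the right values: left of entry 1 stands the
    last entry of row \<open>i\<close>, and for \<open>j = n\<close> position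
    \<open>k - n + 1\<close> is the first entry of row \<open>i + 1\<close>.\<close>
  moreover have "ticker_tape n x (k - 1) \<longleftrightarrow> (if j = 1 then int n \<in> y i else j - 1 \<in> tau n (y i))"
    using entry[of "int n" i] entry[of "j - 1" "i + 1"] y(2)[of i] j by (auto simp: k algebra_simps)
  moreover have "ticker_tape n x (k - int n + 1) \<longleftrightarrow>
      (if j = int n then 1 \<in> tau n (y i) else j + 1 \<in> y i)"
    using entry[of 1 "i + 1"] entry[of "j + 1" i] y(2)[of i] j by (auto simp: k algebra_simps)
  ultimately show "ticker_tape n x k \<longleftrightarrow> \<not> ticker_tape n x (k - 1) \<and>
      \<not> ticker_tape n x (k - int n + 1) \<and> \<not> ticker_tape n x (k - int n)"
    using mem_tau_iff[OF assms(1) y(1)[of i] j] by auto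
qed

theorem theorem2p25:
  fixes n :: nat and x :: "int set"
  assumes "n \<ge> 2" and "x \<in> independent_sets n"
  shows "int (tape_period (ticker_tape n x)) =
           gcd (slither_shift n (ticker_tape n x)) (coslither_shift n (ticker_tape n x)) \<and>
         real (tape_period (ticker_tape n x)) =
           real_of_int (tape_scale n (ticker_tape n x)) /
             (real (tape_deg n (ticker_tape n x)) * real (tape_codeg n (ticker_tape n x)))"
proof -
  interpret tape_rule n "ticker_tape n x" using assms by (rule tape_rule_ticker_tape)
  show ?thesis
    using period_formula by (simp add: field_simps flip: period_formula(2))
qed

end
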